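(* Let $k\ge 1$. A design matrix $D^*$ (a square $\{-1,1\}$-matrix of order $2k$) is a d-optimal saturated design in $\mathcal{G}(k,1)$ if and only if it can be written as $$D^*=\begin{bmatrix} M_1^* & M_1^*\\ -N_1^* & N_1^*\end{bmatrix},$$ where $M_1^*$ and $N_1^*$ are elements of $\mathcal{M}_k\{-1,1\}$ whose determinants have maximal absolute value among elements of $\mathcal{M}_k\{-1,1\}$. Furthermore, for such $D^*$, $|\det(D^* )|=2^k\Theta_k^2$.
   Context: $1_m$ denotes the all-ones column vector of length $m$, and $*$ between vectors denotes the Schur (entrywise) product. $\mathcal{M}_k\{-1,1\}$ is the set of non-singular $k\times k$ matrices with entries in $\{-1,1\}$ whose first column is $1_k$. $\Theta_k$ is the maximum of $|\det(M)|$ over $M\in\mathcal{M}_k\{-1,1\}$. $\mathcal{G}(k,1)$ is the set of saturated design matrices for the mean $F_0$, the main effects $F_1,\dots,F_k$ and the two-factor interactions $F_{12},\dots,F_{1k}$ in a two-level factorial experiment with $k$ factors. That is, it is the set of non-singular $2k\times 2k$ matrices with entries in $\{-1,1\}$ whose columns are, in this order, $F_1,\dots,F_k,F_0,F_{12},\dots,F_{1k}$, where $F_0=1_{2k}=F_1*F_1$ and $F_{1j}=F_1*F_j$ for $2\le j\le k$. Rows (runs) are ordered so that $F_1=\begin{bmatrix}1_{f_+}\\ -1_{f_-}\end{bmatrix}$ for some nonnegative integers $f_+,f_-$ with $f_++f_-=2k$ (the values $f_+,f_-$ are not prescribed). A d-optimal saturated design in $\mathcal{G}(k,1)$ is an element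 of $\mathcal{G}(k,1)$ whose determinant has maximal absolute value among all elements of $\mathcal{G}(k,1)$. *)

theory Defs
  imports "Jordan_Normal_Form.Determinant"
begin

definition ones_vec :: "nat \<Rightarrow> real vec" where
  "ones_vec m = vec m (\<lambda>_. 1)"

definition schur_vec :: "real vec \<Rightarrow> real vec \<Rightarrow> real vec" where
  "schur_vec u v = vec (dim_vec u) (\<lambda>i. u $ i * v $ i)"

definition sign_nonsingular_mats :: "nat \<Rightarrow> real mat set" where
  "sign_nonsingular_mats n =
     {A \<in> carrier_mat n n. elements_mat A \<subseteq> {-1, 1} \<and> det A \<noteq> 0}"

definition M_set :: "nat \<Rightarrow> real mat set" where
  "M_set k = {M \<in> sign_nonsingular_mats k. col M 0 = ones_vec k}"

definition Theta :: "nat \<Rightarrow> real" where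
  "Theta k = Max ((\<lambda>M. \<bar>det M\<bar>) ` M_set k)"

text \<open>The vector \<open>F j\<close> is the column of the main effect of factor \<open>j\<close>, for \<open>1 \<le> j \<le> k\<close>;
  other values of \<open>F\<close> are irrelevant.\<close>

definition design_mat :: "nat \<Rightarrow> (nat \<Rightarrow> real vec) \<Rightarrow> real mat" where
  "design_mat k F = mat_of_cols (2 * k)
     (map F [1..<Suc k] @ [ones_vec (2 * k)] @ map (\<lambda>j. schur_vec (F 1) (F j)) [2..<Suc k])"

definition G_set :: "nat \<Rightarrow> real mat set" where
  "G_set k = {D \<in> sign_nonsingular_mats (2 * k).
     \<exists>F. (\<forall>j\<in>{1..k}. F j \<in> carrier_vec (2 * k)) \<and>
         (\<exists>f_plus f_minus. f_plus + f_minus = 2 * k \<and>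
            F 1 = ones_vec f_plus @\<^sub>v (- ones_vec f_minus)) \<and>
         D = design_mat k F}"

definition maximal_abs_det_in :: "real mat set \<Rightarrow> real mat \<Rightarrow> bool" where
  "maximal_abs_det_in S A \<longleftrightarrow> A \<in> S \<and> (\<forall>B\<in>S. \<bar>det B\<bar> \<le> \<bar>det A\<bar>)"

definition d_optimal :: "nat \<Rightarrow> real mat \<Rightarrow> bool" where
  "d_optimal k D \<longleftrightarrow> maximal_abs_det_in (G_set k) D"

end

theory Submission
  imports Defs
begin

text \<open>
  The runs at the high level of the first factor have the form \<open>(x, x)\<close> and those at the low level
  the form \<open>(-y, y)\<close>, where \<open>x\<close> and \<open>y\<close> start with \<open>1\<close>. Hence a design matrix is
  \<open>[M, M; -N, N]\<close> with \<open>M\<close> and \<open>N\<close> of width \<open>k\<close>. If \<open>M\<close> had fewer than \<open>k\<close> rows, it would kill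
  some \<open>v \<noteq> 0\<close> and the design would kill \<open>(v, v)\<close>; likewise for \<open>N\<close> and \<open>(v, -v)\<close>. So both blocks
  are square, and subtracting the first block column from the second gives
  \<open>det D = 2^k det M det N\<close>, which is maximised by maximising both factors independently.
\<close>

section \<open>Linear algebra of the block shape \<open>[M, M; -N, N]\<close>\<close>

lemma exists_kernel_vec_wide:
  fixes A :: "'a :: idom mat"
  assumes A: "A \<in> carrier_mat m n" and mn: "m < n"
  shows "\<exists>v \<in> carrier_vec n. v \<noteq> 0\<^sub>v n \<and> A *\<^sub>v v = 0\<^sub>v m"
proof -
  \<comment> \<open>\<open>A\<close> is padded with zero rows to a square matrix. Row
    \<open>m\<close> exists because \<open>m < n\<close>; singling it out matches the form of
    \<open>det_row_0\<close>.\<close>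
  define B where "B = mat\<^sub>r n n (\<lambda>i. if i = m then 0\<^sub>v n else if i < m then row A i else 0\<^sub>v n)"
  have B: "B \<in> carrier_mat n n"
    by (simp add: B_def)
  have "det B = 0"
    unfolding B_def by (rule det_row_0) (use mn A in auto)
  then obtain v where v: "v \<in> carrier_vec n" "v \<noteq> 0\<^sub>v n" "B *\<^sub>v v = 0\<^sub>v n"
    using det_0_iff_vec_prod_zero[OF B] by auto
  have "A *\<^sub>v v = 0\<^sub>v m"
  proof (rule eq_vecI)
    fix i assume "i < dim_vec (0\<^sub>v m :: 'a vec)"
    then have i: "i < m" by simp
    have "row B i = row A i"
      using i mn A by (intro eq_vecI) (auto simp: B_def)
    then have "(A *\<^sub>v v) $ i = (B *\<^sub>v v) $ i"
      using i mn A B by simp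
    then show "(A *\<^sub>v v) $ i = 0\<^sub>v m $ i"
      using v i mn by simp
  qed (use A in simp)
  then show ?thesis using v by blast
qed

lemma det_design_block:
  fixes M N :: "'a :: idom mat"
  assumes M: "M \<in> carrier_mat k k" and N: "N \<in> carrier_mat k k"
  shows "det (four_block_mat M M (- N) N) = 2 ^ k * det M * det N"
proof -
  let ?D = "four_block_mat M M (- N) N"
  \<comment> \<open>Right multiplication by \<open>?E\<close> subtracts the first block column from
    the second; \<open>?E\<close> is unipotent, so the determinant is unchanged.\<close>
  let ?E = "four_block_mat (1\<^sub>m k) (- 1\<^sub>m k) (0\<^sub>m k k) (1\<^sub>m k :: 'a mat)"
  have D: "?D \<in> carrier_mat (k + k) (k + k)" and E: "?E \<in> carrier_mat (k + k) (k + k)"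
    using M N by auto
  have "?D * ?E = four_block_mat (M * 1\<^sub>m k + M * 0\<^sub>m k k) (M * (- 1\<^sub>m k) + M * 1\<^sub>m k)
      (- N * 1\<^sub>m k + N * 0\<^sub>m k k) (- N * (- 1\<^sub>m k) + N * 1\<^sub>m k)"
    by (rule mult_four_block_mat) (use M N in auto)
  also have "M * 1\<^sub>m k + M * 0\<^sub>m k k = M"
    using M by simp
  also have "M * (- 1\<^sub>m k) + M * 1\<^sub>m k = 0\<^sub>m k k"
    using M by (intro eq_matI) auto
  also have "- N * 1\<^sub>m k + N * 0\<^sub>m k k = - N"
    using N by simp
  also have "- N * (- 1\<^sub>m k) + N * 1\<^sub>m k = 2 \<cdot>\<^sub>m N"
    using N by (intro eq_matI) auto
  finally have "det (?D * ?E) = det (four_block_mat M (0\<^sub>m k k) (- N) (2 \<cdot>\<^sub>m N))"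
    by simp
  \<comment> \<open>The factor \<open>2 ^ k\<close> comes from here: each of the \<open>k\<close>
    rows of \<open>N\<close> is doubled.\<close>
  also have "\<dots> = det M * det (2 \<cdot>\<^sub>m N)"
    by (rule det_four_block_mat_upper_right_zero) (use M N in auto)
  finally have "det ?D * det ?E = 2 ^ k * det M * det N"
    using N det_mult[OF D E] by simp
  moreover have "det ?E = det (1\<^sub>m k) * det (1\<^sub>m k :: 'a mat)"
    by (rule det_four_block_mat_lower_left_zero) auto
  ultimately show ?thesis by simp
qed

text \<open>The numbers of runs at the two levels of the first factor are not prescribed.
  Nonsingularity alone forces them to be equal, by excluding a kernel vector in either
  block.\<close>

lemma design_block_square:
  fixes M N :: "'a :: {idom, ring_char_0} mat"
  assumes M: "M \<in> carrier_mat p k" and N: "N \<in> carrier_mat q k" and pq: "p + q = k + k"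
    and nz: "det (four_block_mat M M (- N) N) \<noteq> 0"
  shows "p = k" "q = k"
proof -
  let ?D = "four_block_mat M M (- N) N"
  have D: "?D \<in> carrier_mat (k + k) (k + k)"
    using M N pq by auto
  have mult: "?D *\<^sub>v (v @\<^sub>v w) = (M *\<^sub>v v + M *\<^sub>v w) @\<^sub>v (- N *\<^sub>v v + N *\<^sub>v w)"
    if "v \<in> carrier_vec k" "w \<in> carrier_vec k" for v w
    by (rule four_block_mat_mult_vec) (use M N that in auto)
  have inj: "v = 0\<^sub>v k" if "v \<in> carrier_vec k" "w \<in> carrier_vec k" "?D *\<^sub>v (v @\<^sub>v w) = 0\<^sub>v (k + k)"
    for v w
  proof -
    have "v @\<^sub>v w = 0\<^sub>v (k + k)"
      using nz that det_0_iff_vec_prod_zero[OF D] by auto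
    then have "(v @\<^sub>v w) $ i = 0" if "i < k" for i
      using that by simp
    then show ?thesis
      using that by (intro eq_vecI) auto
  qed
  have "\<not> p < k"
  proof
    assume "p < k"
    then obtain v where v: "v \<in> carrier_vec k" "v \<noteq> 0\<^sub>v k" "M *\<^sub>v v = 0\<^sub>v p"
      using exists_kernel_vec_wide[OF M] by blast
    \<comment> \<open>The lower rows give \<open>-N v + N v\<close>, which cancels for every
      \<open>v\<close>; the upper rows vanish as \<open>M\<close> kills \<open>v\<close>.\<close>
    have "?D *\<^sub>v (v @\<^sub>v v) = 0\<^sub>v (k + k)"
      unfolding mult[OF v(1) v(1)] using v N pq
      by (intro eq_vecI) auto
    then show False using inj[OF v(1) v(1)] v(2) by blast
  qed
  moreover have "\<not> q < k"
  proof
    assume "q < k"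
    then obtain v where v: "v \<in> carrier_vec k" "v \<noteq> 0\<^sub>v k" "N *\<^sub>v v = 0\<^sub>v q"
      using exists_kernel_vec_wide[OF N] by blast
    have mv: "- v \<in> carrier_vec k" using v by simp
    have neg: "A *\<^sub>v (- v) = - (A *\<^sub>v v)" if "A \<in> carrier_mat r k" for A :: "'a mat" and r
      using that v by (intro eq_vecI) auto
    have "N *\<^sub>v (- v) = 0\<^sub>v q" "- N *\<^sub>v v = 0\<^sub>v q"
      using v N by (auto simp: neg[OF N])
    \<comment> \<open>The sign of the second half is flipped so that now the upper rows cancel, as
      \<open>M v - M v\<close>.\<close>
    then have "?D *\<^sub>v (v @\<^sub>v - v) = 0\<^sub>v (k + k)"
      unfolding mult[OF v(1) mv] using v M pq
      by (intro eq_vecI) (auto simp: neg[OF M])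
    then show False using inj[OF v(1) mv] v(2) by blast
  qed
  ultimately show "p = k" "q = k" using pq by auto
qed

section \<open>Sign matrices: entrywise description and finiteness\<close>

lemma elements_mat_subset_iff:
  assumes "A \<in> carrier_mat m n"
  shows "elements_mat A \<subseteq> S \<longleftrightarrow> (\<forall>i<m. \<forall>j<n. A $$ (i, j) \<in> S)"
  using assms by fastforce

lemma finite_mats_with_elements_in:
  assumes "finite S"
  shows "finite {A \<in> carrier_mat m n. elements_mat A \<subseteq> S}"
proof (rule finite_subset)
  let ?P = "PiE ({..<m} \<times> {..<n}) (\<lambda>_. S)"
  show "finite ((\<lambda>f. mat m n f) ` ?P)"
    using assms by (intro finite_imageI finite_PiE) auto
  show "{A \<in> carrier_mat m n. elements_mat A \<subseteq> S} \<subseteq> (\<lambda>f. mat m n f) ` ?P"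
  proof
    fix A assume "A \<in> {A \<in> carrier_mat m n. elements_mat A \<subseteq> S}"
    then have A: "A \<in> carrier_mat m n" and S: "\<forall>i<m. \<forall>j<n. A $$ (i, j) \<in> S"
      by (auto simp: elements_mat_subset_iff)
    have "A = mat m n (restrict (\<lambda>ij. A $$ ij) ({..<m} \<times> {..<n}))"
      using A by (intro eq_matI) auto
    then show "A \<in> (\<lambda>f. mat m n f) ` ?P"
      by (rule image_eqI[where f = "mat m n"]) (use S in auto)
  qed
qed

lemma finite_M_set: "finite (M_set k)"
  by (rule finite_subset[OF _ finite_mats_with_elements_in[of "{-1, 1}" k k]])
    (auto simp: M_set_def sign_nonsingular_mats_def)

text \<open>\<open>Max\<close> is a true maximum only on a finite nonempty set. Finiteness is
  \<open>finite_M_set\<close>; the maximiser itself shows nonemptiness.\<close>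

lemma abs_det_eq_Theta:
  assumes "maximal_abs_det_in (M_set k) M"
  shows "\<bar>det M\<bar> = Theta k"
  using assms unfolding Theta_def maximal_abs_det_in_def
  by (intro Max_eqI[symmetric] finite_imageI finite_M_set) auto

lemma M_set_iff:
  assumes "k \<ge> 1"
  shows "M \<in> M_set k \<longleftrightarrow> M \<in> carrier_mat k k \<and> (\<forall>i<k. \<forall>j<k. M $$ (i, j) \<in> {-1, 1}) \<and>
    det M \<noteq> 0 \<and> (\<forall>i<k. M $$ (i, 0) = 1)"
proof (cases "M \<in> carrier_mat k k")
  case True
  then have "col M 0 = ones_vec k \<longleftrightarrow> (\<forall>i<k. M $$ (i, 0) = 1)"
    using assms by (auto simp: vec_eq_iff ones_vec_def)
  then show ?thesis
    using True by (auto simp: M_set_def sign_nonsingular_mats_def elements_mat_subset_iff)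
qed (auto simp: M_set_def sign_nonsingular_mats_def)

section \<open>Entrywise description of designs\<close>

lemma design_mat_carrier:
  assumes "k \<ge> 1"
  shows "design_mat k F \<in> carrier_mat (2 * k) (2 * k)"
  using assms by (auto simp: design_mat_def)

text \<open>Factors are numbered from 1 and columns from 0, hence \<open>Suc j\<close>. Column
  \<open>k\<close> holds the mean, and the interactions follow it.\<close>

lemma design_mat_index:
  assumes "i < 2 * k" "j < k" and F: "F 1 \<in> carrier_vec (2 * k)"
  shows "design_mat k F $$ (i, j) = F (Suc j) $ i"
    and "design_mat k F $$ (i, k + j) = (if j = 0 then 1 else F 1 $ i * F (Suc j) $ i)"
proof -
  show "design_mat k F $$ (i, j) = F (Suc j) $ i"
    using assms unfolding design_mat_def
    by (subst mat_of_cols_index) (auto simp: nth_append simp del: upt_Suc)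
  show "design_mat k F $$ (i, k + j) = (if j = 0 then 1 else F 1 $ i * F (Suc j) $ i)"
    using assms unfolding design_mat_def
    by (subst mat_of_cols_index)
      (auto simp: nth_append nth_Cons' ones_vec_def schur_vec_def simp del: upt_Suc)
qed

text \<open>This eliminates the family \<open>F\<close>, which can be read off the first
  \<open>k\<close> columns. The case \<open>j = 0\<close> encodes the mean column, as the square of
  a sign is 1.\<close>

lemma G_set_iff:
  assumes k: "k \<ge> 1"
  shows "D \<in> G_set k \<longleftrightarrow> D \<in> sign_nonsingular_mats (2 * k) \<and>
    (\<exists>p \<le> 2 * k. \<forall>i < 2 * k. D $$ (i, 0) = (if i < p then 1 else -1) \<and>
       (\<forall>j<k. D $$ (i, k + j) = D $$ (i, 0) * D $$ (i, j)))"
    (is "_ \<longleftrightarrow> _ \<and> (\<exists>p \<le> 2 * k. ?P p)")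
proof (intro iffI)
  assume "D \<in> G_set k"
  then obtain F p q where D: "D \<in> sign_nonsingular_mats (2 * k)"
    and F: "\<forall>j\<in>{1..k}. F j \<in> carrier_vec (2 * k)" and pq: "p + q = 2 * k"
    and F1: "F 1 = ones_vec p @\<^sub>v (- ones_vec q)" and DF: "D = design_mat k F"
    unfolding G_set_def by blast
  have F1c: "F 1 \<in> carrier_vec (2 * k)" using F k by auto
  have idx: "F 1 $ i = (if i < p then 1 else -1)" if "i < 2 * k" for i
    unfolding F1 using that pq by (auto simp: ones_vec_def)
  have "?P p"
    using k idx by (auto simp: DF design_mat_index[where F = F, OF _ _ F1c])
  then show "D \<in> sign_nonsingular_mats (2 * k) \<and> (\<exists>p \<le> 2 * k. ?P p)"
    using D pq by (metis le_add1)
next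
  assume "D \<in> sign_nonsingular_mats (2 * k) \<and> (\<exists>p \<le> 2 * k. ?P p)"
  then obtain p where D: "D \<in> sign_nonsingular_mats (2 * k)" and p: "p \<le> 2 * k" and P: "?P p"
    by blast
  have Dc: "D \<in> carrier_mat (2 * k) (2 * k)"
    using D by (simp add: sign_nonsingular_mats_def)
  define F where "F j = col D (j - 1)" for j
  have F: "\<forall>j\<in>{1..k}. F j \<in> carrier_vec (2 * k)"
    using Dc by (auto simp: F_def intro!: carrier_vecI)
  have F1c: "F 1 \<in> carrier_vec (2 * k)" using F k by auto
  have F1: "F 1 = ones_vec p @\<^sub>v (- ones_vec (2 * k - p))"
    using Dc P p k by (intro eq_vecI) (auto simp: F_def ones_vec_def)
  have "D = design_mat k F"
  proof (rule eq_matI)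
    fix i j
    assume "i < dim_row (design_mat k F)" "j < dim_col (design_mat k F)"
    then have i: "i < 2 * k" and j: "j < 2 * k"
      using design_mat_carrier[OF k, of F] by auto
    show "D $$ (i, j) = design_mat k F $$ (i, j)"
    proof (cases "j < k")
      case True
      then show ?thesis using i j Dc by (simp add: design_mat_index[where F = F, OF _ _ F1c] F_def)
    next
      case False
      then obtain l where l: "j = k + l" "l < k"
        using j by (metis add_less_cancel_left le_add_diff_inverse mult_2 not_less)
      \<comment> \<open>Needed for \<open>l = 0\<close>, where the product rule has to yield the
        all-ones column.\<close>
      have D0: "D $$ (i, 0) * D $$ (i, 0) = 1"
        using P i by auto
      have "D $$ (i, k + l) = D $$ (i, 0) * D $$ (i, l)"
        using P i l by blast
      then show ?thesis
        using i l Dc D0 by (simp add: design_mat_index[where F = F, OF _ _ F1c] F_def)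
    qed
  qed (use Dc design_mat_carrier[OF k, of F] in auto)
  moreover have "p + (2 * k - p) = 2 * k"
    using p by simp
  ultimately show "D \<in> G_set k"
    unfolding G_set_def using D F F1 by blast
qed

section \<open>Designs correspond to pairs of elements of \<open>M_set k\<close>\<close>

lemma design_block_in_G_set:
  assumes k: "k \<ge> 1" and M: "M \<in> M_set k" and N: "N \<in> M_set k"
  shows "four_block_mat M M (- N) N \<in> G_set k"
proof -
  let ?D = "four_block_mat M M (- N) N"
  note M' = M[unfolded M_set_iff[OF k]] and N' = N[unfolded M_set_iff[OF k]]
  have D: "?D \<in> carrier_mat (2 * k) (2 * k)"
    using M' N' by auto
  have "det ?D \<noteq> 0"
    using M' N' det_design_block[of M k N] by auto
  moreover have "?D $$ (i, j) \<in> {-1, 1}" if "i < 2 * k" "j < 2 * k" for i j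
  proof -
    have M: "M $$ (a, b) \<in> {-1, 1}" and N: "N $$ (a, b) \<in> {-1, 1}" "- N $$ (a, b) \<in> {-1, 1}"
      if "a < k" "b < k" for a b
      using M' N' that by fastforce+
    have dim: "dim_row M = k" "dim_col M = k" "dim_row N = k" "dim_col N = k"
      using M' N' by auto
    consider "i < k" "j < k" | "i < k" "\<not> j < k" | "\<not> i < k" "j < k" | "\<not> i < k" "\<not> j < k"
      by blast
    then show ?thesis
    proof cases
      case 1
      then show ?thesis using M[of i j] that by (simp add: dim)
    next
      case 2
      then show ?thesis using M[of i "j - k"] that by (simp add: dim)
    next
      case 3
      then show ?thesis using N(2)[of "i - k" j] that by (simp add: dim)
    next
      case 4
      then show ?thesis using N(1)[of "i - k" "j - k"] that by (simp add: dim)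
    qed
  qed
  ultimately have "?D \<in> sign_nonsingular_mats (2 * k)"
    using D by (auto simp: sign_nonsingular_mats_def elements_mat_subset_iff)
  moreover have "\<forall>i < 2 * k. ?D $$ (i, 0) = (if i < k then 1 else -1) \<and>
       (\<forall>j<k. ?D $$ (i, k + j) = ?D $$ (i, 0) * ?D $$ (i, j))"
    using M' N' k by auto
  ultimately show ?thesis
    unfolding G_set_iff[OF k] by (auto intro!: exI[of _ k])
qed

lemma G_set_obtain_blocks:
  assumes k: "k \<ge> 1" and D: "D \<in> G_set k"
  obtains M N where "M \<in> M_set k" "N \<in> M_set k" "D = four_block_mat M M (- N) N"
proof -
  obtain p where sgn: "D \<in> sign_nonsingular_mats (2 * k)" and p: "p \<le> 2 * k"
    and P: "\<And>i. i < 2 * k \<Longrightarrow> D $$ (i, 0) = (if i < p then 1 else -1)"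
      "\<And>i j. i < 2 * k \<Longrightarrow> j < k \<Longrightarrow> D $$ (i, k + j) = D $$ (i, 0) * D $$ (i, j)"
    using D unfolding G_set_iff[OF k] by blast
  have Dc: "D \<in> carrier_mat (2 * k) (2 * k)" and nz: "det D \<noteq> 0"
    and el: "\<And>i j. i < 2 * k \<Longrightarrow> j < 2 * k \<Longrightarrow> D $$ (i, j) \<in> {-1, 1}"
    using sgn by (auto simp: sign_nonsingular_mats_def elements_mat_subset_iff)
  define M where "M = mat p k (\<lambda>(i, j). D $$ (i, j))"
  \<comment> \<open>\<open>N\<close> is read from the right half: on the low runs the first factor
    is \<open>-1\<close>, so there the left half is the negative of the right and \<open>N\<close>
    starts with a column of ones.\<close>
  define N where "N = mat (2 * k - p) k (\<lambda>(i, j). D $$ (p + i, k + j))"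
  have M: "M \<in> carrier_mat p k" and N: "N \<in> carrier_mat (2 * k - p) k"
    by (auto simp: M_def N_def)
  have eq: "D = four_block_mat M M (- N) N"
  proof (rule eq_matI)
    fix i j
    assume "i < dim_row (four_block_mat M M (- N) N)" "j < dim_col (four_block_mat M M (- N) N)"
    then have i: "i < 2 * k" and j: "j < 2 * k"
      using p by (auto simp: M_def N_def)
    show "D $$ (i, j) = four_block_mat M M (- N) N $$ (i, j)"
      using i j p P(1)[of i] P(2)[of i j] P(2)[of i "j - k"]
      by (auto simp: M_def N_def)
  qed (use Dc p in \<open>auto simp: M_def N_def\<close>)
  \<comment> \<open>Up to this point the blocks may be rectangular.\<close>
  have pk: "p = k"
    using design_block_square(1)[OF M N] p nz eq by simp
  have M: "M \<in> carrier_mat k k" and N: "N \<in> carrier_mat k k"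
    using M N pk by auto
  have "det M \<noteq> 0" "det N \<noteq> 0"
    using nz det_design_block[OF M N] eq by auto
  moreover have "M $$ (i, 0) = 1" "N $$ (i, 0) = 1" if "i < k" for i
    using that k P(1)[of i] P(1)[of "k + i"] P(2)[of "k + i" 0] by (auto simp: M_def N_def pk)
  moreover have "M $$ (i, j) \<in> {-1, 1}" "N $$ (i, j) \<in> {-1, 1}" if "i < k" "j < k" for i j
    using that el[of i j] el[of "k + i" "k + j"] by (auto simp: M_def N_def pk)
  ultimately have "M \<in> M_set k" "N \<in> M_set k"
    using M N unfolding M_set_iff[OF k] by blast+
  then show thesis using that eq by blast
qed

section \<open>Optimality\<close>

lemma abs_det_design_block:
  assumes "M \<in> M_set k" "N \<in> M_set k"
  shows "\<bar>det (four_block_mat M M (- N) N)\<bar> = 2 ^ k * (\<bar>det M\<bar> * \<bar>det N\<bar>)"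
  using assms det_design_block[of M k N]
  by (simp add: M_set_def sign_nonsingular_mats_def abs_mult)

lemma d_optimal_iff:
  assumes k: "k \<ge> 1"
  shows "d_optimal k D \<longleftrightarrow>
    (\<exists>M N. maximal_abs_det_in (M_set k) M \<and> maximal_abs_det_in (M_set k) N \<and>
       D = four_block_mat M M (- N) N)"
proof
  assume opt: "d_optimal k D"
  then have "D \<in> G_set k" by (simp add: d_optimal_def maximal_abs_det_in_def)
  then obtain M N where M: "M \<in> M_set k" and N: "N \<in> M_set k"
    and D: "D = four_block_mat M M (- N) N"
    using G_set_obtain_blocks[OF k] by blast
  have pos: "\<bar>det M\<bar> > 0" "\<bar>det N\<bar> > 0"
    using M N by (auto simp: M_set_def sign_nonsingular_mats_def)
  \<comment> \<open>Any two elements of \<open>M_set k\<close> form a competing design; the common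
    factor \<open>2 ^ k\<close> cancels.\<close>
  have le: "\<bar>det A\<bar> * \<bar>det B\<bar> \<le> \<bar>det M\<bar> * \<bar>det N\<bar>" if "A \<in> M_set k" "B \<in> M_set k" for A B
    using opt design_block_in_G_set[OF k that] that M N
    by (auto simp: d_optimal_def maximal_abs_det_in_def D abs_det_design_block)
  \<comment> \<open>Taking \<open>B = N\<close> in \<open>le\<close> and cancelling the positive
    \<open>|det N|\<close> isolates the first factor.\<close>
  have "maximal_abs_det_in (M_set k) M"
    unfolding maximal_abs_det_in_def using M le[OF _ N] pos by auto
  moreover have "maximal_abs_det_in (M_set k) N"
    unfolding maximal_abs_det_in_def using N le[OF M] pos by auto
  ultimately show "\<exists>M N. maximal_abs_det_in (M_set k) M \<and> maximal_abs_det_in (M_set k) N \<and>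
       D = four_block_mat M M (- N) N"
    using D by blast
next
  assume "\<exists>M N. maximal_abs_det_in (M_set k) M \<and> maximal_abs_det_in (M_set k) N \<and>
       D = four_block_mat M M (- N) N"
  then obtain M N where M: "maximal_abs_det_in (M_set k) M" and N: "maximal_abs_det_in (M_set k) N"
    and D: "D = four_block_mat M M (- N) N"
    by blast
  have MN: "M \<in> M_set k" "N \<in> M_set k"
    using M N by (auto simp: maximal_abs_det_in_def)
  have "\<bar>det B\<bar> \<le> \<bar>det D\<bar>" if B: "B \<in> G_set k" for B
  proof -
    obtain M' N' where B': "M' \<in> M_set k" "N' \<in> M_set k" "B = four_block_mat M' M' (- N') N'"
      using G_set_obtain_blocks[OF k B] by blast
    have "\<bar>det M'\<bar> * \<bar>det N'\<bar> \<le> \<bar>det M\<bar> * \<bar>det N\<bar>"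
      using M N B' by (intro mult_mono) (auto simp: maximal_abs_det_in_def)
    then show ?thesis
      using B' MN D by (simp add: abs_det_design_block)
  qed
  then show "d_optimal k D"
    using design_block_in_G_set[OF k MN] D by (auto simp: d_optimal_def maximal_abs_det_in_def)
qed

theorem corollary1:
  fixes k :: nat and D :: "real mat"
  assumes "k \<ge> 1"
    and "D \<in> carrier_mat (2 * k) (2 * k)"
    and "elements_mat D \<subseteq> {-1, 1}"
  shows "(d_optimal k D \<longleftrightarrow>
           (\<exists>M N. maximal_abs_det_in (M_set k) M \<and> maximal_abs_det_in (M_set k) N \<and>
                  D = four_block_mat M M (- N) N)) \<and>
         (d_optimal k D \<longrightarrow> \<bar>det D\<bar> = 2 ^ k * (Theta k)\<^sup>2)"
proof (intro conjI impI)
  show iff: "d_optimal k D \<longleftrightarrow>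
      (\<exists>M N. maximal_abs_det_in (M_set k) M \<and> maximal_abs_det_in (M_set k) N \<and>
         D = four_block_mat M M (- N) N)"
    by (rule d_optimal_iff[OF assms(1)])
  assume "d_optimal k D"
  then obtain M N where max: "maximal_abs_det_in (M_set k) M" "maximal_abs_det_in (M_set k) N"
    and D: "D = four_block_mat M M (- N) N"
    using iff by blast
  then have "\<bar>det D\<bar> = 2 ^ k * (\<bar>det M\<bar> * \<bar>det N\<bar>)"
    by (simp add: abs_det_design_block maximal_abs_det_in_def)
  then show "\<bar>det D\<bar> = 2 ^ k * (Theta k)\<^sup>2"
    using max by (simp add: abs_det_eq_Theta power2_eq_square)
qed

end
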